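(* Let $n\in\mathbb N$, let $A\in M_n(\mathbb R)$ with $\det A\neq0$, and let $\hat\alpha=(\alpha_1,\ldots,\alpha_n)\in(0,1]^n$. Then for every $\epsilon>0$ there exists $\hat\beta=(\beta_1,\ldots,\beta_n)\in((0,1]\cap\mathbb Q)^n$ which is an $\epsilon$-rational approximation of $\hat\alpha$ associated with $A$.
   Context: $M_n(\mathbb R)$ is the set of real $n\times n$ matrices. Arguments are principal, $\arg(z)\in(-\pi,\pi]$, and for $\beta\in(0,1]$, $z^\beta=|z|^\beta\exp(\mathrm i\beta\arg(z))$ (principal branch, with $0^\beta=0$). For $\hat\gamma=(\gamma_1,\ldots,\gamma_n)\in(0,1]^n$ put $z^{\hat\gamma}I=\operatorname{diag}(z^{\gamma_1},\ldots,z^{\gamma_n})$. The $\hat\gamma$-order spectrum of $A$ is $\sigma_{\hat\gamma}(A)=\{z\in\mathbb C:\det(z^{\hat\gamma}I-A)=0\}$. For $\epsilon>0$, the (Euclidean) $\hat\gamma$-order $\epsilon$-pseudospectrum is $\sigma^2_{\hat\gamma,\epsilon}(A)=\{z\in\mathbb C:\|(z^{\hat\gamma}I-A)^{-1}\|_2^{-1}\le\epsilon\}$, where $\|\cdot\|_2$ is the matrix norm induced by the Euclidean norm and $\|M^{-1}\|_2^{-1}$ is taken to be $0$ when $\det M=0$. Definition. Given $A\in M_n(\mathbb R)$, $\hat\alpha\in(0,1]^n$ and $\epsilon>0$, a multi-index $\hat\beta=(\beta_1,\ldots,\beta_n)\in((0,1]\cap\mathbb Q)^n$ is an $\epsilon$-rational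 approximation of $\hat\alpha$ associated with $A$ if: (i) $0<\beta_i\le\alpha_i\le1$ for all $i\in\{1,\ldots,n\}$; (ii) there exists a constant $R\ge1$ such that $\sigma^2_{\hat\alpha,\epsilon}(A)\cap\{z\in\mathbb C:|z|>R\}=\sigma^2_{\hat\beta,\epsilon}(A)\cap\{z\in\mathbb C:|z|>R\}=\emptyset$; (iii) there exists a constant $\rho\in(0,1)$ such that $\sigma_{\hat\alpha}(A)\cap\{z\in\mathbb C:|z|<\rho\}=\sigma_{\hat\beta}(A)\cap\{z\in\mathbb C:|z|<\rho\}=\emptyset$; (iv) for $R$ and $\rho$ chosen as in (ii) and (iii), $\sup_{\rho\le|z|\le R}|z^{\alpha_i}-z^{\beta_i}|<\epsilon$ for all $i\in\{1,\ldots,n\}$. (That is, there is a single pair $R,\rho$ for which (ii), (iii) and (iv) hold; $R$ and $\rho$ may depend on $A,\hat\alpha,\epsilon$.) *)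

theory Defs
  imports "HOL-Analysis.Analysis"
begin

(* Complex powr, with the library convention 0 powr b = 0, is the principal power
   |z|^b exp(i b arg z) with arg z in (-pi, pi]. *)
lemma powr_of_real_principal:
  fixes z :: complex and b :: real
  assumes "0 < b"
  shows "z powr of_real b = of_real (cmod z powr b) * exp (\<i> * of_real (b * Arg z))"
proof (cases "z = 0")
  case True
  then show ?thesis by simp
next
  case False
  then have "Ln z = of_real (ln (cmod z)) + \<i> * of_real (Arg z)"
    by (simp add: Arg_eq_Im_Ln complex_eq_iff)
  with False have "z powr of_real b
      = exp (of_real (b * ln (cmod z)) + \<i> * of_real (b * Arg z))"
    by (simp add: powr_def algebra_simps)
  with False show ?thesis
    by (simp add: exp_add powr_def flip: exp_of_real)
qed

definition powr_diag :: "complex \<Rightarrow> real^'n \<Rightarrow> complex^'n^'n" where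
  "powr_diag z \<gamma> = (\<chi> i j. if i = j then z powr of_real (\<gamma> $ i) else 0)"

definition order_spectrum :: "real^'n \<Rightarrow> real^'n^'n \<Rightarrow> complex set" where
  "order_spectrum \<gamma> A = {z. det (powr_diag z \<gamma> - map_matrix of_real A) = 0}"

(* The norm on complex^'n is Euclidean, so onorm is the induced 2-norm. The singular case is
   separate because matrix_inv is unspecified there. *)
definition inv_norm_inv :: "complex^'n^'n \<Rightarrow> real" where
  "inv_norm_inv M = (if det M = 0 then 0 else inverse (onorm (\<lambda>x. matrix_inv M *v x)))"

definition order_pseudospectrum :: "real \<Rightarrow> real^'n \<Rightarrow> real^'n^'n \<Rightarrow> complex set" where
  "order_pseudospectrum \<epsilon> \<gamma> A = {z. inv_norm_inv (powr_diag z \<gamma> - map_matrix of_real A) \<le> \<epsilon>}"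

(* The supremum in the last condition is over a nonempty set (\<rho> < 1 \<le> R) and of a bounded function,
   so the real-valued SUP is the usual supremum. *)
definition rational_approximation ::
    "real \<Rightarrow> real^'n^'n \<Rightarrow> real^'n \<Rightarrow> real^'n \<Rightarrow> bool" where
  "rational_approximation \<epsilon> A \<alpha> \<beta> \<longleftrightarrow>
     (\<forall>i. \<beta> $ i \<in> {0<..1} \<inter> \<rat>) \<and>
     (\<forall>i. 0 < \<beta> $ i \<and> \<beta> $ i \<le> \<alpha> $ i \<and> \<alpha> $ i \<le> 1) \<and>
     (\<exists>R \<rho>. R \<ge> 1 \<and> 0 < \<rho> \<and> \<rho> < 1 \<and>
        order_pseudospectrum \<epsilon> \<alpha> A \<inter> {z. cmod z > R} = {} \<and>
        order_pseudospectrum \<epsilon> \<beta> A \<inter> {z. cmod z > R} = {} \<and>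
        order_spectrum \<alpha> A \<inter> {z. cmod z < \<rho>} = {} \<and>
        order_spectrum \<beta> A \<inter> {z. cmod z < \<rho>} = {} \<and>
        (\<forall>i. (SUP z\<in>{z. \<rho> \<le> cmod z \<and> cmod z \<le> R}.
               cmod (z powr of_real (\<alpha> $ i) - z powr of_real (\<beta> $ i))) < \<epsilon>))"

end

theory Submission
  imports Defs
begin

text \<open>
  The radii \<open>R\<close> and \<open>\<rho>\<close> may depend on \<open>\<alpha>\<close>, but they have to serve \<open>\<alpha>\<close> and the still unknown
  \<open>\<beta>\<close> at once. This circularity is broken by fixing a common lower bound for the orders first:
  \<open>m = min \<alpha>\<^sub>i / 2\<close>. For every \<open>\<gamma>\<close> with all entries at least \<open>m\<close>, the diagonal entries
  satisfy \<open>|z|\<^bsup>\<gamma>\<^sub>i\<^esup> \<ge> |z|\<^bsup>m\<^esup>\<close> outside the unit disc and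
  \<open>|z|\<^bsup>\<gamma>\<^sub>i\<^esup> \<le> |z|\<^bsup>m\<^esup>\<close> inside. Hence:

  \<^item> For large \<open>|z|\<close> the diagonal part dominates \<open>A\<close>, and the smallest singular value of
    \<open>z\<^bsup>\<gamma>\<^esup> I - A\<close> is at least \<open>|z|\<^bsup>m\<^esup> - \<parallel>A\<parallel> > \<epsilon>\<close>
    (\<open>pseudospectrum_bounded_uniformly\<close>).

  \<^item> For small \<open>|z|\<close> the invertible matrix \<open>A\<close> dominates: its smallest singular value exceeds
    \<open>|z|\<^bsup>m\<^esup>\<close>, so the difference stays invertible (\<open>spectrum_avoids_zero_uniformly\<close>).

  Thus \<open>A\<close>, \<open>\<epsilon>\<close> and \<open>m\<close> determine \<open>R\<close> and \<open>\<rho>\<close> before \<open>\<beta>\<close> is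
  chosen. On the resulting annulus, which is bounded and stays away from the branch point \<open>0\<close>,
  the logarithm is bounded, and \<open>z\<^bsup>a\<^esup>\<close> is therefore
  continuous in the exponent uniformly in \<open>z\<close> (\<open>powr_uniformly_close_on_annulus\<close>). The branch
  cut does no harm, because \<open>z\<close> is the same on both sides. Density of the rationals then
  gives \<open>\<beta>\<^sub>i\<close> just below \<open>\<alpha>\<^sub>i\<close> and above \<open>m\<close>.

  Singular values are replaced throughout by lower bounds \<open>c |x| \<le> |M x|\<close>.
\<close>

section \<open>Matrices bounded below\<close>

lemma det_nonzero_if_bounded_below:
  fixes M :: "complex^'n^'n"
  assumes "0 < c" and bound: "\<And>x. c * norm x \<le> norm (M *v x)"
  shows "det M \<noteq> 0"
proof -
  have "x = y" if "M *v x = M *v y" for x y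
  proof -
    have "M *v (x - y) = 0"
      using that by (simp add: matrix_vector_mult_diff_distrib)
    then have "c * norm (x - y) \<le> 0"
      using bound[of "x - y"] by simp
    then show ?thesis
      using \<open>0 < c\<close> by (simp add: mult_le_0_iff)
  qed
  then have "inj ((*v) M)"
    by (rule injI)
  then show ?thesis
    by (metis invertible_det_nz invertible_left_inverse matrix_left_invertible_injective)
qed

lemma bounded_below_if_det_nonzero:
  fixes M :: "complex^'n^'n"
  assumes "det M \<noteq> 0"
  obtains c where "0 < c" and "\<And>x. c * norm x \<le> norm (M *v x)"
proof -
  obtain B where B: "B ** M = mat 1"
    using assms by (meson invertible_def invertible_det_nz)
  define K where "K = onorm ((*v) B) + 1"
  have "0 < K"
    using onorm_pos_le[OF matrix_vector_mul_bounded_linear, of B] by (simp add: K_def)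
  have "norm x \<le> K * norm (M *v x)" for x
  proof -
    have "norm x = norm (B *v (M *v x))"
      by (simp add: matrix_vector_mul_assoc B)
    also have "\<dots> \<le> onorm ((*v) B) * norm (M *v x)"
      by (rule onorm[OF matrix_vector_mul_bounded_linear])
    also have "\<dots> \<le> K * norm (M *v x)"
      by (simp add: K_def mult_right_mono)
    finally show ?thesis .
  qed
  then show thesis
    using \<open>0 < K\<close> by (intro that[of "inverse K"]) (simp_all add: field_simps)
qed

text \<open>
  The value \<open>inv_norm_inv M\<close> is the smallest singular value of \<open>M\<close>, so it is at least every lower
  bound. Inverting \<open>\<parallel>M\<^sup>-\<^sup>1\<parallel> \<le> 1/c\<close> requires \<open>\<parallel>M\<^sup>-\<^sup>1\<parallel> > 0\<close>.
\<close>

lemma inv_norm_inv_ge: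
  fixes M :: "complex^'n^'n"
  assumes "0 < c" and bound: "\<And>x. c * norm x \<le> norm (M *v x)"
  shows "c \<le> inv_norm_inv M"
proof -
  have nz: "det M \<noteq> 0"
    using assms by (rule det_nonzero_if_bounded_below)
  have "M ** matrix_inv M = mat 1 \<and> matrix_inv M ** M = mat 1"
    unfolding matrix_inv_def
    by (rule someI_ex) (use nz in \<open>simp add: invertible_det_nz flip: invertible_def\<close>)
  then have right: "M *v (matrix_inv M *v y) = y"
    and left: "matrix_inv M *v (M *v y) = y" for y
    by (simp_all add: matrix_vector_mul_assoc)
  have "norm (matrix_inv M *v y) \<le> inverse c * norm y" for y
    using bound[of "matrix_inv M *v y"] \<open>0 < c\<close> by (simp add: right field_simps)
  then have upper: "onorm ((*v) (matrix_inv M)) \<le> inverse c"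
    by (rule onorm_le)
  obtain e :: "complex^'n" where e: "norm e = 1"
    by (rule vector_choose_size[of 1]) auto
  have "matrix_inv M *v (M *v e) \<noteq> 0"
    using e by (auto simp: left)
  then have "0 < onorm ((*v) (matrix_inv M))"
    using onorm_pos_lt[OF matrix_vector_mul_bounded_linear, of "matrix_inv M"] by blast
  with upper have "c \<le> inverse (onorm ((*v) (matrix_inv M)))"
    using \<open>0 < c\<close> by (simp add: field_simps)
  with nz show ?thesis
    by (simp add: inv_norm_inv_def)
qed

lemma det_map_matrix_of_real:
  fixes A :: "real^'n^'n"
  shows "det (map_matrix of_real A :: complex^'n^'n) = of_real (det A)"
  by (simp add: det_def)

section \<open>Diagonal matrices of powers\<close>

lemma powr_diag_mult_nth:
  "(powr_diag z \<gamma> *v x) $ i = z powr of_real (\<gamma> $ i) * x $ i"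
  by (simp add: powr_diag_def matrix_vector_mult_def if_distrib[of "\<lambda>a. a * _"] cong: if_cong)

lemma powr_diag_norm_ge:
  assumes "\<And>i. k \<le> cmod z powr (\<gamma> $ i)" and "0 \<le> k"
  shows "k * norm x \<le> norm (powr_diag z \<gamma> *v x)"
  unfolding norm_vec_def L2_set_right_distrib[OF \<open>0 \<le> k\<close>]
  by (rule L2_set_mono)
     (simp_all add: powr_diag_mult_nth norm_mult norm_powr_real_powr' assms mult_right_mono)

lemma powr_diag_norm_le:
  assumes "\<And>i. cmod z powr (\<gamma> $ i) \<le> k" and "0 \<le> k"
  shows "norm (powr_diag z \<gamma> *v x) \<le> k * norm x"
  unfolding norm_vec_def L2_set_right_distrib[OF \<open>0 \<le> k\<close>]
  by (rule L2_set_mono)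
     (simp_all add: powr_diag_mult_nth norm_mult norm_powr_real_powr' assms mult_right_mono)

section \<open>Radii that depend only on a lower bound for the orders\<close>

text \<open>
  With \<open>K = \<parallel>A\<parallel> + \<epsilon> + 1\<close> and \<open>R = K\<^bsup>1/m\<^esup>\<close>, every diagonal entry exceeds \<open>K\<close> in modulus
  beyond \<open>R\<close>, which leaves \<open>K - \<parallel>A\<parallel> > \<epsilon>\<close> for the difference.
\<close>

lemma pseudospectrum_bounded_uniformly:
  fixes A :: "real^'n^'n"
  assumes "0 < m" and "0 < \<epsilon>"
  obtains R where "1 \<le> R"
    and "\<And>\<gamma>. (\<And>i. m \<le> \<gamma> $ i) \<Longrightarrow> order_pseudospectrum \<epsilon> \<gamma> A \<inter> {z. cmod z > R} = {}"
proof -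
  let ?A = "map_matrix of_real A :: complex^'n^'n"
  define C where "C = onorm ((*v) ?A)"
  have "0 \<le> C"
    unfolding C_def by (rule onorm_pos_le[OF matrix_vector_mul_bounded_linear])
  define K where "K = C + \<epsilon> + 1"
  have "1 \<le> K"
    using \<open>0 \<le> C\<close> \<open>0 < \<epsilon>\<close> by (simp add: K_def)
  define R where "R = K powr (1/m)"
  have "1 \<le> R"
    using \<open>1 \<le> K\<close> \<open>0 < m\<close> by (simp add: R_def ge_one_powr_ge_zero)
  have "z \<notin> order_pseudospectrum \<epsilon> \<gamma> A"
    if m: "\<And>i. m \<le> \<gamma> $ i" and z: "R < cmod z" for \<gamma> :: "real^'n" and z
  proof -
    have "K \<le> cmod z powr (\<gamma> $ i)" for i
    proof -
      have "K = R powr m"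
        using \<open>1 \<le> K\<close> \<open>0 < m\<close> by (simp add: R_def powr_powr)
      also have "\<dots> \<le> cmod z powr m"
        using z \<open>1 \<le> R\<close> \<open>0 < m\<close> by (intro powr_mono2) auto
      also have "\<dots> \<le> cmod z powr (\<gamma> $ i)"
        using z \<open>1 \<le> R\<close> m by (intro powr_mono) auto
      finally show ?thesis .
    qed
    then have D: "K * norm x \<le> norm (powr_diag z \<gamma> *v x)" for x
      using \<open>1 \<le> K\<close> by (intro powr_diag_norm_ge) auto
    have "(\<epsilon> + 1) * norm x \<le> norm ((powr_diag z \<gamma> - ?A) *v x)" for x
    proof -
      have "norm (?A *v x) \<le> C * norm x"
        unfolding C_def by (rule onorm[OF matrix_vector_mul_bounded_linear])
      then have "(\<epsilon> + 1) * norm x \<le> norm (powr_diag z \<gamma> *v x) - norm (?A *v x)"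
        using D[of x] by (simp add: K_def algebra_simps)
      also have "\<dots> \<le> norm ((powr_diag z \<gamma> - ?A) *v x)"
        by (simp add: matrix_vector_mult_diff_rdistrib norm_triangle_ineq2)
      finally show ?thesis .
    qed
    then have "\<epsilon> + 1 \<le> inv_norm_inv (powr_diag z \<gamma> - ?A)"
      using \<open>0 < \<epsilon>\<close> by (intro inv_norm_inv_ge) auto
    then show ?thesis
      by (simp add: order_pseudospectrum_def)
  qed
  with \<open>1 \<le> R\<close> show thesis
    by (intro that) auto
qed

text \<open>
  If \<open>c |x| \<le> |A x|\<close>, half of \<open>c\<close> is reserved for the diagonal part: its entries are at most
  \<open>c/2\<close> in modulus within \<open>(c/2)\<^bsup>1/m\<^esup>\<close> of the origin. Taking the minimum with \<open>1/2\<close> keeps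
  \<open>z\<close> inside the unit disc, where larger orders give smaller powers.
\<close>

lemma spectrum_avoids_zero_uniformly:
  fixes A :: "real^'n^'n"
  assumes "0 < m" and "det A \<noteq> 0"
  obtains \<rho> where "0 < \<rho>" and "\<rho> < 1"
    and "\<And>\<gamma>. (\<And>i. m \<le> \<gamma> $ i) \<Longrightarrow> order_spectrum \<gamma> A \<inter> {z. cmod z < \<rho>} = {}"
proof -
  let ?A = "map_matrix of_real A :: complex^'n^'n"
  have "det ?A \<noteq> 0"
    using assms(2) by (simp add: det_map_matrix_of_real)
  then obtain c where "0 < c" and c: "\<And>x. c * norm x \<le> norm (?A *v x)"
    using bounded_below_if_det_nonzero by blast
  define \<rho> where "\<rho> = min (1/2) ((c/2) powr (1/m))"
  have "0 < \<rho>" "\<rho> < 1"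
    using \<open>0 < c\<close> by (auto simp: \<rho>_def)
  have "z \<notin> order_spectrum \<gamma> A"
    if m: "\<And>i. m \<le> \<gamma> $ i" and z: "cmod z < \<rho>" for \<gamma> :: "real^'n" and z
  proof -
    have "cmod z powr (\<gamma> $ i) \<le> c/2" for i
    proof -
      have "cmod z powr (\<gamma> $ i) \<le> cmod z powr m"
        using z \<open>\<rho> < 1\<close> m by (intro powr_mono') auto
      also have "\<dots> \<le> ((c/2) powr (1/m)) powr m"
        using z \<open>0 < m\<close> by (intro powr_mono2) (auto simp: \<rho>_def)
      also have "\<dots> = c/2"
        using \<open>0 < c\<close> \<open>0 < m\<close> by (simp add: powr_powr)
      finally show ?thesis .
    qed
    then have D: "norm (powr_diag z \<gamma> *v x) \<le> c/2 * norm x" for x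
      using \<open>0 < c\<close> by (intro powr_diag_norm_le) auto
    have "c/2 * norm x \<le> norm ((powr_diag z \<gamma> - ?A) *v x)" for x
    proof -
      have "c/2 * norm x \<le> norm (?A *v x) - norm (powr_diag z \<gamma> *v x)"
        using c[of x] D[of x] by simp
      also have "\<dots> \<le> norm ((powr_diag z \<gamma> - ?A) *v x)"
        by (metis matrix_vector_mult_diff_rdistrib norm_minus_commute norm_triangle_ineq2)
      finally show ?thesis .
    qed
    then have "det (powr_diag z \<gamma> - ?A) \<noteq> 0"
      using \<open>0 < c\<close> by (intro det_nonzero_if_bounded_below[of "c/2"]) auto
    then show ?thesis
      by (simp add: order_spectrum_def)
  qed
  with \<open>0 < \<rho>\<close> \<open>\<rho> < 1\<close> show thesis
    by (intro that) auto
qed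

section \<open>Continuity of powers in the exponent\<close>

text \<open>
  Factor \<open>z\<^bsup>a\<^esup> - z\<^bsup>b\<^esup> = z\<^bsup>b\<^esup> (exp ((a - b) Ln z) - 1)\<close>. On the annulus the first factor is at
  most \<open>R\<close> in modulus and \<open>Ln z\<close> is bounded, so that continuity of \<open>exp\<close> at \<open>0\<close> suffices.
\<close>

lemma powr_uniformly_close_on_annulus:
  assumes "0 < \<rho>" and "1 \<le> R" and "0 < \<epsilon>"
  obtains \<delta> where "0 < \<delta>"
    and "\<And>a b z. \<lbrakk>\<bar>a - b\<bar> < \<delta>; b \<le> 1; 0 \<le> b; \<rho> \<le> cmod z; cmod z \<le> R\<rbrakk>
           \<Longrightarrow> cmod (z powr of_real a - z powr of_real b) \<le> \<epsilon>"
proof -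
  have "isCont (exp :: complex \<Rightarrow> complex) 0"
    by (rule isCont_exp)
  then obtain d where "0 < d" and d: "\<And>w. cmod w < d \<Longrightarrow> cmod (exp w - 1) < \<epsilon>/R"
    using assms unfolding continuous_at_eps_delta
    by (metis (no_types, lifting) diff_zero dist_norm divide_pos_pos exp_zero less_le_trans zero_less_one)
  define L where "L = \<bar>ln \<rho>\<bar> + \<bar>ln R\<bar> + pi"
  have "0 < L"
    using pi_gt_zero by (simp add: L_def add_nonneg_pos)
  have "cmod (z powr of_real a - z powr of_real b) \<le> \<epsilon>"
    if ab: "\<bar>a - b\<bar> < d/L" and b: "b \<le> 1" "0 \<le> b" and z: "\<rho> \<le> cmod z" "cmod z \<le> R" for a b z
  proof -
    have "z \<noteq> 0"
      using z \<open>0 < \<rho>\<close> by auto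
    have "ln \<rho> \<le> ln (cmod z)" "ln (cmod z) \<le> ln R"
      using z \<open>0 < \<rho>\<close> \<open>z \<noteq> 0\<close> by (auto intro!: ln_mono)
    then have "\<bar>ln (cmod z)\<bar> \<le> \<bar>ln \<rho>\<bar> + \<bar>ln R\<bar>"
      by linarith
    moreover have "\<bar>Im (Ln z)\<bar> \<le> pi"
      using mpi_less_Im_Ln[OF \<open>z \<noteq> 0\<close>] Im_Ln_le_pi[OF \<open>z \<noteq> 0\<close>] by linarith
    ultimately have "cmod (Ln z) \<le> L"
      using cmod_le[of "Ln z"] \<open>z \<noteq> 0\<close> by (simp add: L_def)
    then have "cmod (of_real (a - b) * Ln z) \<le> \<bar>a - b\<bar> * L"
      by (simp add: norm_mult mult_left_mono del: of_real_diff)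
    also have "\<dots> < d"
      using ab \<open>0 < L\<close> by (simp add: field_simps)
    finally have E: "cmod (exp (of_real (a - b) * Ln z) - 1) < \<epsilon>/R"
      by (rule d)
    have "cmod z powr b \<le> R powr b"
      using z b by (intro powr_mono2) auto
    also have "\<dots> \<le> R powr 1"
      using \<open>1 \<le> R\<close> b by (intro powr_mono) auto
    finally have P: "cmod (z powr of_real b) \<le> R"
      using \<open>1 \<le> R\<close> by (simp add: norm_powr_real_powr')
    have "z powr of_real a - z powr of_real b
        = z powr of_real b * (exp (of_real (a - b) * Ln z) - 1)"
      using \<open>z \<noteq> 0\<close> by (simp add: powr_def algebra_simps flip: exp_add)
    then have "cmod (z powr of_real a - z powr of_real b)
        = cmod (z powr of_real b) * cmod (exp (of_real (a - b) * Ln z) - 1)"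
      by (simp only: norm_mult)
    also have "\<dots> \<le> R * (\<epsilon>/R)"
      using P E \<open>1 \<le> R\<close> by (intro mult_mono) auto
    finally show ?thesis
      using \<open>1 \<le> R\<close> by simp
  qed
  with \<open>0 < d\<close> \<open>0 < L\<close> show thesis
    by (intro that[of "d/L"]) auto
qed

section \<open>Existence of rational approximations\<close>

theorem proposition4p2:
  fixes A :: "real^'n^'n" and \<alpha> :: "real^'n" and \<epsilon> :: real
  assumes "det A \<noteq> 0"
    and "\<forall>i. \<alpha> $ i \<in> {0<..1}"
    and "\<epsilon> > 0"
  shows "\<exists>\<beta>. (\<forall>i. \<beta> $ i \<in> {0<..1} \<inter> \<rat>) \<and> rational_approximation \<epsilon> A \<alpha> \<beta>"
proof -
  have \<alpha>: "0 < \<alpha> $ i" "\<alpha> $ i \<le> 1" for i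
    using assms(2) by auto
  define m where "m = Min (range (\<lambda>i. \<alpha> $ i)) / 2"
  have "0 < m"
    using \<alpha> by (simp add: m_def)
  have "Min (range (\<lambda>i. \<alpha> $ i)) \<le> \<alpha> $ i" for i
    by simp
  then have m: "m < \<alpha> $ i" for i
    using \<open>0 < m\<close> by (smt (verit) field_sum_of_halves m_def)
  obtain R where "1 \<le> R"
    and R: "\<And>\<gamma>. (\<And>i. m \<le> \<gamma> $ i) \<Longrightarrow> order_pseudospectrum \<epsilon> \<gamma> A \<inter> {z. cmod z > R} = {}"
    using pseudospectrum_bounded_uniformly[OF \<open>0 < m\<close> assms(3)] by blast
  obtain \<rho> where "0 < \<rho>" "\<rho> < 1"
    and \<rho>: "\<And>\<gamma>. (\<And>i. m \<le> \<gamma> $ i) \<Longrightarrow> order_spectrum \<gamma> A \<inter> {z. cmod z < \<rho>} = {}"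
    using spectrum_avoids_zero_uniformly[OF \<open>0 < m\<close> assms(1)] by blast
  (* A strict pointwise bound by \<epsilon> alone would only bound the supremum by \<epsilon>; hence \<epsilon>/2. *)
  have "0 < \<epsilon>/2"
    using assms(3) by simp
  then obtain \<delta> where "0 < \<delta>"
    and \<delta>: "\<And>a b z. \<lbrakk>\<bar>a - b\<bar> < \<delta>; b \<le> 1; 0 \<le> b; \<rho> \<le> cmod z; cmod z \<le> R\<rbrakk>
              \<Longrightarrow> cmod (z powr of_real a - z powr of_real b) \<le> \<epsilon>/2"
    using powr_uniformly_close_on_annulus[OF \<open>0 < \<rho>\<close> \<open>1 \<le> R\<close>] by blast
  have "\<exists>q\<in>\<rat>. max m (\<alpha> $ i - \<delta>) < q \<and> q < \<alpha> $ i" for i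
    using m[of i] \<open>0 < \<delta>\<close> by (intro Rats_dense_in_real) auto
  then obtain b where b: "\<And>i. b i \<in> \<rat>" "\<And>i. max m (\<alpha> $ i - \<delta>) < b i" "\<And>i. b i < \<alpha> $ i"
    by metis
  define \<beta> :: "real^'n" where "\<beta> = (\<chi> i. b i)"
  have \<beta>: "\<beta> $ i \<in> \<rat>" "m < \<beta> $ i" "\<alpha> $ i - \<delta> < \<beta> $ i" "\<beta> $ i < \<alpha> $ i" for i
    using b[of i] by (simp_all add: \<beta>_def)
  have \<beta>01: "0 < \<beta> $ i" "\<beta> $ i \<le> 1" for i
    using \<beta>[of i] \<alpha>[of i] \<open>0 < m\<close> by linarith+
  have sup: "(SUP z\<in>{z. \<rho> \<le> cmod z \<and> cmod z \<le> R}.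
          cmod (z powr of_real (\<alpha> $ i) - z powr of_real (\<beta> $ i))) < \<epsilon>" for i
  proof -
    have "1 \<in> {z. \<rho> \<le> cmod z \<and> cmod z \<le> R}"
      using \<open>\<rho> < 1\<close> \<open>1 \<le> R\<close> by simp
    then have "{z. \<rho> \<le> cmod z \<and> cmod z \<le> R} \<noteq> {}"
      by blast
    then have "(SUP z\<in>{z. \<rho> \<le> cmod z \<and> cmod z \<le> R}.
          cmod (z powr of_real (\<alpha> $ i) - z powr of_real (\<beta> $ i))) \<le> \<epsilon>/2"
      using \<beta>[of i] \<beta>01[of i] by (intro cSUP_least \<delta>) simp_all
    then show ?thesis
      using assms(3) by linarith
  qed
  have outer: "order_pseudospectrum \<epsilon> \<alpha> A \<inter> {z. cmod z > R} = {}"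
    "order_pseudospectrum \<epsilon> \<beta> A \<inter> {z. cmod z > R} = {}"
    using m \<beta>(2) by (simp_all add: R less_imp_le)
  have inner: "order_spectrum \<alpha> A \<inter> {z. cmod z < \<rho>} = {}"
    "order_spectrum \<beta> A \<inter> {z. cmod z < \<rho>} = {}"
    using m \<beta>(2) by (simp_all add: \<rho> less_imp_le)
  have "\<beta> $ i \<in> {0<..1} \<inter> \<rat>" "0 < \<beta> $ i \<and> \<beta> $ i \<le> \<alpha> $ i \<and> \<alpha> $ i \<le> 1" for i
    using \<beta>[of i] \<beta>01[of i] \<alpha>[of i] by auto
  with outer inner sup have "rational_approximation \<epsilon> A \<alpha> \<beta>"
    unfolding rational_approximation_def
    using \<open>1 \<le> R\<close> \<open>0 < \<rho>\<close> \<open>\<rho> < 1\<close> by blast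
  then show ?thesis
    using \<beta>(1) \<beta>01 by auto
qed

end
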